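(* Let $(Y,\mathcal{Y},m,S)$ be a dynamical system on a probability space with a state space $(X,\mathcal{X})$ having property (M), let $T$ be the associated averaging operator, and let $\lambda:=\|T\|_{L^2_0(X)}$; assume $0<\lambda<1$. Let $\varphi\colon Y\to[0,1]$ be an $\mathcal{X}$-measurable function, let $\eta\in[0,1]$, let $n\ge 1$ be an integer and let $\theta\in\lambda^{\mathbb{N}}:=\{\lambda^k\mid k\in\mathbb{N}\}\subseteq(0,\lambda]$, where $\mathbb{N}=\{1,2,\dots\}$. (a) If $m(\varphi)<1$, $\eta\ge m(\varphi)$ and $\theta\le\frac{\eta-m(\varphi)}{1-m(\varphi)}$, then $$m\left(\left\{y\;\middle|\;\frac1n\sum_{i=0}^{n-1}\varphi(S^iy)\ge\eta\right\}\right)\le\frac{\log\theta}{\log\lambda}\,\exp\big(D(\eta\,\|\,m(\varphi))\big)\cdot\exp\left[-n(-\log\lambda)\frac{D(\eta\,\|\,\theta+(1-\theta)m(\varphi))}{-\log\theta}\right].$$ (b) If $m(\varphi)>0$, $\eta\le m(\varphi)$ and $\theta\le\frac{m(\varphi)-\eta}{m(\varphi)}$, then $$m\left(\left\{y\;\middle|\;\frac1n\sum_{i=0}^{n-1}\varphi(S^iy)\le\eta\right\}\right)\le\frac{\log\theta}{\log\lambda}\,\exp\big(D(\eta\,\|\,m(\varphi))\big)\cdot\exp\left[-n(-\log\lambda)\frac{D(\eta\,\|\,(1-\theta)m(\varphi))}{-\log\theta}\right].$$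
   Context: A dynamical system $(Y,\mathcal{Y},m,S)$ is a probability space $(Y,\mathcal{Y},m)$ with a measure-preserving (not necessarily invertible) map $S\colon Y\to Y$. A state space for it is a measurable space $(X,\mathcal{X})$ with a measurable map $\pi\colon Y\to X$; $X$ carries the measure $\pi_*m$ (also denoted $m$), and $\mathcal{X}$ is identified with the sub-$\sigma$-algebra $\pi^{-1}\mathcal{X}\subseteq\mathcal{Y}$, so $L^q(X)\subseteq L^q(Y)$ is the subspace of $\mathcal{X}$-measurable functions. $S$ need not descend to $X$. $U_Sf=f\circ S$ is the Koopman operator on $L^2(Y)$, $P_X$ is the orthogonal projection of $L^2(Y)$ onto $L^2(X)$, and the averaging operator is $T=T_S:=P_XU_SP_X$, regarded also as an operator $L^2(X)\to L^2(X)$. $L^2_0(X)$ is the orthogonal complement of the constant functions in $L^2(X)$, and $\|T\|_{L^2_0(X)}$ is the operator norm of $T$ restricted to $L^2_0(X)$. Property (M): there exists a closed subspace $\mathcal{M}\subseteq L^2(Y)$ that is stable under multiplication by elements of $L^\infty(X)$ and stable under $U_S$, such that $L^2(X)\subseteq\mathcal{M}$ and $P_XU_SP_Xf=P_XU_Sf$ for all $f\in\mathcal{M}$. $m(\varphi)=\int\varphi\,dm$. For $a,b\in[0,1]$, $D(a\,\|\,b):=-a\log\frac ba-(1-a)\log\frac{1-b}{1-a}$ is the binary Kullback–Leibler divergence (natural logarithm), with the usual conventions $0\log 0=0$ and $D(a\,\|\,b)=+\infty$ if $b=0<a$ or $b=1>a$. *)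

theory Defs
  imports "HOL-Probability.Probability"
begin

locale dynamical_system = prob_space M for M :: "'a measure" +
  fixes S :: "'a \<Rightarrow> 'a"
  assumes S_measurable: "S \<in> measurable M M"
    and S_invariant: "distr M M S = M"

text \<open>Only the space and the sigma-algebra of \<open>N\<close> matter; its own measure is never used.\<close>

locale dynamical_system_with_state_space = dynamical_system M S
  for M :: "'a measure" and S :: "'a \<Rightarrow> 'a" +
  fixes N :: "'b measure" and \<pi> :: "'a \<Rightarrow> 'b"
  assumes \<pi>_measurable: "\<pi> \<in> measurable M N"

definition state_algebra :: "'a measure \<Rightarrow> 'b measure \<Rightarrow> ('a \<Rightarrow> 'b) \<Rightarrow> 'a measure" where
  "state_algebra M N \<pi> = vimage_algebra (space M) \<pi> N"

text \<open>
  Elements of the (real) \<open>L\<^sup>2\<close> spaces are represented by functions; equality in \<open>L\<^sup>2\<close> is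
  equality almost everywhere. Throughout, \<open>F\<close> is a sub-sigma-algebra of \<open>M\<close>, playing the role of
  \<open>\<pi>\<^sup>-\<^sup>1\<X>\<close>.
\<close>

definition L2 :: "'a measure \<Rightarrow> ('a \<Rightarrow> real) set" where
  "L2 M = {f \<in> borel_measurable M. integrable M (\<lambda>x. (f x)\<^sup>2)}"

definition L2_norm :: "'a measure \<Rightarrow> ('a \<Rightarrow> real) \<Rightarrow> real" where
  "L2_norm M f = sqrt (\<integral>x. (f x)\<^sup>2 \<partial>M)"

definition L2_sub :: "'a measure \<Rightarrow> 'a measure \<Rightarrow> ('a \<Rightarrow> real) set" where
  "L2_sub M F = {f \<in> L2 M. f \<in> borel_measurable F}"

definition L2_sub0 :: "'a measure \<Rightarrow> 'a measure \<Rightarrow> ('a \<Rightarrow> real) set" where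
  "L2_sub0 M F = {f \<in> L2_sub M F. \<forall>c. (\<integral>x. f x * c \<partial>M) = 0}"

definition Linf_sub :: "'a measure \<Rightarrow> 'a measure \<Rightarrow> ('a \<Rightarrow> real) set" where
  "Linf_sub M F = {g \<in> borel_measurable F. \<exists>C. AE x in M. \<bar>g x\<bar> \<le> C}"

definition koopman :: "('a \<Rightarrow> 'a) \<Rightarrow> ('a \<Rightarrow> real) \<Rightarrow> 'a \<Rightarrow> real" where
  "koopman S f = f \<circ> S"

text \<open>
  The choice is unique up to equality almost everywhere (for \<open>f \<in> L2 M\<close>).
\<close>

definition L2_proj :: "'a measure \<Rightarrow> 'a measure \<Rightarrow> ('a \<Rightarrow> real) \<Rightarrow> 'a \<Rightarrow> real" where
  "L2_proj M F f =
     (SOME g. g \<in> L2_sub M F \<and> (\<forall>h\<in>L2_sub M F. (\<integral>x. (f x - g x) * h x \<partial>M) = 0))"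

definition averaging_op ::
    "'a measure \<Rightarrow> 'a measure \<Rightarrow> ('a \<Rightarrow> 'a) \<Rightarrow> ('a \<Rightarrow> real) \<Rightarrow> 'a \<Rightarrow> real" where
  "averaging_op M F S f = L2_proj M F (koopman S (L2_proj M F f))"

text \<open>
  A real supremum: the set contains \<open>0\<close> and is bounded above by \<open>1\<close>, the averaging
  operator being a contraction.
\<close>

definition averaging_norm0 :: "'a measure \<Rightarrow> 'a measure \<Rightarrow> ('a \<Rightarrow> 'a) \<Rightarrow> real" where
  "averaging_norm0 M F S =
     Sup {L2_norm M (averaging_op M F S f) | f. f \<in> L2_sub0 M F \<and> L2_norm M f \<le> 1}"

text \<open>
  Closedness with respect to the seminorm also forces \<open>V\<close> to be closed under equality almost
  everywhere (constant sequences), so \<open>V\<close> is a genuine set of \<open>L\<^sup>2\<close> classes.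
\<close>

definition closed_L2_subspace :: "'a measure \<Rightarrow> ('a \<Rightarrow> real) set \<Rightarrow> bool" where
  "closed_L2_subspace M V \<longleftrightarrow>
     V \<subseteq> L2 M \<and>
     (\<lambda>x. 0) \<in> V \<and>
     (\<forall>f\<in>V. \<forall>g\<in>V. (\<lambda>x. f x + g x) \<in> V) \<and>
     (\<forall>c. \<forall>f\<in>V. (\<lambda>x. c * f x) \<in> V) \<and>
     (\<forall>u f. (\<forall>k::nat. u k \<in> V) \<longrightarrow> f \<in> L2 M \<longrightarrow>
        (\<lambda>k. L2_norm M (\<lambda>x. u k x - f x)) \<longlonglongrightarrow> 0 \<longrightarrow> f \<in> V)"

definition property_M :: "'a measure \<Rightarrow> 'a measure \<Rightarrow> ('a \<Rightarrow> 'a) \<Rightarrow> bool" where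
  "property_M M F S \<longleftrightarrow>
     (\<exists>V. closed_L2_subspace M V \<and>
          (\<forall>g\<in>Linf_sub M F. \<forall>f\<in>V. (\<lambda>x. g x * f x) \<in> V) \<and>
          (\<forall>f\<in>V. koopman S f \<in> V) \<and>
          L2_sub M F \<subseteq> V \<and>
          (\<forall>f\<in>V. AE x in M.
             L2_proj M F (koopman S (L2_proj M F f)) x = L2_proj M F (koopman S f) x))"

text \<open>
  Binary Kullback--Leibler divergence for \<open>a, b \<in> [0,1]\<close>. The convention \<open>0 log 0 = 0\<close> is
  automatic, since \<open>0 * ln t = 0\<close> for the (junk) values of \<open>t\<close> that arise.
\<close>

definition KL_binary :: "real \<Rightarrow> real \<Rightarrow> ereal" where
  "KL_binary a b =
     (if (b = 0 \<and> 0 < a) \<or> (b = 1 \<and> a < 1) then \<infinity>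
      else ereal (- a * ln (b / a) - (1 - a) * ln ((1 - b) / (1 - a))))"

definition exp_ereal :: "ereal \<Rightarrow> ereal" where
  "exp_ereal t = (case t of ereal r \<Rightarrow> ereal (exp r) | PInfty \<Rightarrow> \<infinity> | MInfty \<Rightarrow> 0)"

end

theory Submission
  imports Defs
begin

text \<open>
  Write \<open>P\<close> for the projection onto the functions of the state, \<open>U\<close> for the Koopman operator,
  \<open>\<lambda>\<close> for the norm of \<open>T = P U P\<close> on mean-zero functions and \<open>\<theta> = \<lambda>\<^sup>k\<close>.

  Property (M) makes \<open>P U\<^sup>k f\<close>, for \<open>f\<close> in the subspace \<open>V\<close> that it provides, depend on \<open>P f\<close> only,
  and contracts it: \<open>\<parallel>P U\<^sup>k f\<parallel> \<le> \<theta> \<parallel>P f\<parallel>\<close> when \<open>f\<close> has mean zero (\<open>proj_pow_decay\<close>). Hence, along the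
  times divisible by \<open>k\<close>, the state process is dominated by the chain which at each step stays where
  it is with probability \<open>\<theta>\<close> and draws a fresh state from \<open>m\<close> with probability \<open>1 - \<theta>\<close>: by
  \<open>transition_form_bound\<close> the bilinear form \<open>\<integral> a (P U\<^sup>k f)\<close> satisfies the Cauchy-Schwarz inequality for
  the quadratic form \<open>energy\<close> of that chain (a Leon-Perron type comparison).

  For a weight \<open>g = exp (t \<phi>)\<close> with values in \<open>[0, e\<^sup>t]\<close>, the energy of \<open>g v\<close> is at most \<open>\<rho> \<integral> g v\<^sup>2\<close>, where
  \<open>\<rho> = (1 - \<theta>) m(g) + \<theta> e\<^sup>t\<close>; this gives \<open>\<integral> \<Prod>i<j. g (S\<^sup>k\<^sup>i y) \<le> \<rho>\<^sup>j\<close> (\<open>multiplicative_moment_bound\<close>). Convexity of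
  \<open>exp\<close> bounds \<open>m(g)\<close> by \<open>1 - \<mu> + \<mu> e\<^sup>t\<close>, hence \<open>\<rho>\<close> by \<open>1 - p + p e\<^sup>t\<close> with \<open>p = \<theta> + (1 - \<theta>) \<mu>\<close>.
  So the exponential moments of the sum over \<open>j\<close> terms of the progression are at most those of a sum
  of \<open>j\<close> independent Bernoulli(\<open>p\<close>) variables, and Chernoff's optimisation over \<open>t\<close> yields \<open>exp (- j D(\<eta> \<parallel> p))\<close>.

  Finally \<open>{0..<n}\<close> splits into \<open>k\<close> residue classes modulo \<open>k\<close>, each of at least \<open>n/k - 1\<close> elements. If
  the full average is at least \<open>\<eta>\<close>, so is the average over some class; the union bound costs the
  factor \<open>k = log \<theta> / log \<lambda>\<close>, and the missing element costs \<open>exp D(\<eta> \<parallel> p) \<le> exp D(\<eta> \<parallel> \<mu>)\<close>, as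
  \<open>\<mu> \<le> p \<le> \<eta>\<close>. The lower tail is the upper tail of \<open>1 - \<phi>\<close>, since \<open>D\<close> is invariant under replacing
  both arguments by their complements.
\<close>

section \<open>Square-integrable functions\<close>

lemma L2_measurable: "f \<in> L2 M \<Longrightarrow> f \<in> borel_measurable M"
  by (simp add: L2_def)

lemma L2_integrable_square: "f \<in> L2 M \<Longrightarrow> integrable M (\<lambda>x. (f x)\<^sup>2)"
  by (simp add: L2_def)

lemma L2_integrable_mult:
  assumes "f \<in> L2 M" "g \<in> L2 M"
  shows "integrable M (\<lambda>x. f x * g x)"
proof (rule Bochner_Integration.integrable_bound)
  show "integrable M (\<lambda>x. (f x)\<^sup>2 + (g x)\<^sup>2)"
    using assms by (simp add: L2_def)
  show "(\<lambda>x. f x * g x) \<in> borel_measurable M"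
    using assms by (auto simp: L2_def)
  have "\<bar>a * b\<bar> \<le> a\<^sup>2 + b\<^sup>2" for a b :: real
    using sum_squares_bound[of "\<bar>a\<bar>" "\<bar>b\<bar>"] mult_nonneg_nonneg[of "\<bar>a\<bar>" "\<bar>b\<bar>"]
    unfolding abs_mult power2_abs by linarith
  then show "AE x in M. norm (f x * g x) \<le> norm ((f x)\<^sup>2 + (g x)\<^sup>2)"
    by simp
qed

lemma L2_add:
  assumes "f \<in> L2 M" "g \<in> L2 M"
  shows "(\<lambda>x. f x + g x) \<in> L2 M"
proof -
  have "integrable M (\<lambda>x. (f x)\<^sup>2 + (g x)\<^sup>2 + 2 * (f x * g x))"
    using assms L2_integrable_mult[OF assms] by (simp add: L2_def)
  then show ?thesis
    using assms by (auto simp: L2_def power2_sum mult.assoc)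
qed

lemma L2_cmult: "f \<in> L2 M \<Longrightarrow> (\<lambda>x. c * f x) \<in> L2 M"
  by (auto simp: L2_def power_mult_distrib)

lemma L2_diff:
  assumes "f \<in> L2 M" "g \<in> L2 M"
  shows "(\<lambda>x. f x - g x) \<in> L2 M"
  using L2_add[OF assms(1) L2_cmult[OF assms(2), of "-1"]] by simp

lemma L2_mult_bounded:
  assumes "f \<in> L2 M" "g \<in> borel_measurable M" "AE x in M. \<bar>g x\<bar> \<le> C"
  shows "(\<lambda>x. g x * f x) \<in> L2 M"
proof -
  have "integrable M (\<lambda>x. (g x * f x)\<^sup>2)"
  proof (rule Bochner_Integration.integrable_bound)
    show "integrable M (\<lambda>x. C\<^sup>2 * (f x)\<^sup>2)"
      using assms by (simp add: L2_def)
    show "(\<lambda>x. (g x * f x)\<^sup>2) \<in> borel_measurable M"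
      using assms by (auto simp: L2_def)
    show "AE x in M. norm ((g x * f x)\<^sup>2) \<le> norm (C\<^sup>2 * (f x)\<^sup>2)"
      using assms(3)
    proof eventually_elim
      case (elim x)
      then have "(g x)\<^sup>2 \<le> C\<^sup>2"
        using power_mono[of "\<bar>g x\<bar>" C 2] by simp
      then show ?case
        by (simp add: power_mult_distrib mult_right_mono)
    qed
  qed
  then show ?thesis
    using assms by (auto simp: L2_def)
qed

lemma L2_norm_nonneg: "0 \<le> L2_norm M f"
  by (simp add: L2_norm_def)

lemma L2_norm_square: "(L2_norm M f)\<^sup>2 = (\<integral>x. (f x)\<^sup>2 \<partial>M)"
  by (simp add: L2_norm_def)

lemma L2_norm_cong_AE:
  assumes "f \<in> borel_measurable M" "g \<in> borel_measurable M" "AE x in M. f x = g x"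
  shows "L2_norm M f = L2_norm M g"
  unfolding L2_norm_def using assms
  by (intro arg_cong[where f=sqrt] integral_cong_AE) auto

lemma L2_norm_cmult: "L2_norm M (\<lambda>x. c * f x) = \<bar>c\<bar> * L2_norm M f"
  by (simp add: L2_norm_def power_mult_distrib real_sqrt_mult)

lemma L2_Cauchy_Schwarz:
  assumes f: "f \<in> L2 M" and g: "g \<in> L2 M"
  shows "(\<integral>x. f x * g x \<partial>M)\<^sup>2 \<le> (\<integral>x. (f x)\<^sup>2 \<partial>M) * (\<integral>x. (g x)\<^sup>2 \<partial>M)"
proof -
  define A B C where "A = (\<integral>x. (f x)\<^sup>2 \<partial>M)" and "B = (\<integral>x. f x * g x \<partial>M)"
    and "C = (\<integral>x. (g x)\<^sup>2 \<partial>M)"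
  note [simp] = L2_integrable_mult[OF f g] L2_integrable_square[OF f] L2_integrable_square[OF g]
  have quad: "0 \<le> A - 2 * t * B + t\<^sup>2 * C" for t
  proof -
    have "0 \<le> (\<integral>x. (f x - t * g x)\<^sup>2 \<partial>M)"
      by simp
    also have "\<dots> = (\<integral>x. (f x)\<^sup>2 - 2 * t * (f x * g x) + t\<^sup>2 * (g x)\<^sup>2 \<partial>M)"
      by (simp add: power2_eq_square algebra_simps)
    also have "\<dots> = A - 2 * t * B + t\<^sup>2 * C"
      by (simp add: A_def B_def C_def)
    finally show ?thesis .
  qed
  have "0 \<le> C"
    by (simp add: C_def)
  show ?thesis
  proof (cases "C = 0")
    case True
    have "B = 0"
      using quad[of "(A + 1) / (2 * B)"] True by (cases "B = 0") auto
    then show ?thesis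
      using True by (simp add: A_def B_def C_def)
  next
    case False
    with \<open>0 \<le> C\<close> have "0 < C" by simp
    then have "B\<^sup>2 \<le> A * C"
      using quad[of "B / C"] by (simp add: power2_eq_square field_simps)
    then show ?thesis
      by (simp add: A_def B_def C_def)
  qed
qed

lemma L2_inner_le_norms:
  assumes "f \<in> L2 M" "g \<in> L2 M"
  shows "(\<integral>x. f x * g x \<partial>M) \<le> L2_norm M f * L2_norm M g"
proof -
  have "\<bar>\<integral>x. f x * g x \<partial>M\<bar> \<le> sqrt ((\<integral>x. (f x)\<^sup>2 \<partial>M) * (\<integral>x. (g x)\<^sup>2 \<partial>M))"
    by (intro real_le_rsqrt) (use L2_Cauchy_Schwarz[OF assms] in simp)
  then show ?thesis
    by (simp add: L2_norm_def real_sqrt_mult)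
qed

section \<open>The projection onto the state space\<close>

text \<open>Only the sub-sigma-algebra that the state map induces enters the argument, so the state space
  is represented by \<open>F\<close>.\<close>

locale state_factor = dynamical_system M S for M :: "'a measure" and S +
  fixes F :: "'a measure"
  assumes state_subalgebra: "subalgebra M F"

sublocale state_factor \<subseteq> finite_measure_subalgebra M F
  by unfold_locales (rule state_subalgebra)

context state_factor
begin

abbreviation P :: "('a \<Rightarrow> real) \<Rightarrow> 'a \<Rightarrow> real" where
  "P \<equiv> L2_proj M F"

lemma L2_sub_L2: "f \<in> L2_sub M F \<Longrightarrow> f \<in> L2 M"
  by (simp add: L2_sub_def)

lemma const_L2_sub: "(\<lambda>x. c) \<in> L2_sub M F"
  by (simp add: L2_sub_def L2_def)

lemma L2_sub_diff: "f \<in> L2_sub M F \<Longrightarrow> g \<in> L2_sub M F \<Longrightarrow> (\<lambda>x. f x - g x) \<in> L2_sub M F"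
  by (auto simp: L2_sub_def L2_diff)

lemma L2_sub_cmult: "f \<in> L2_sub M F \<Longrightarrow> (\<lambda>x. c * f x) \<in> L2_sub M F"
  by (auto simp: L2_sub_def L2_cmult)

lemma Linf_sub_mult_L2:
  assumes "g \<in> Linf_sub M F" "f \<in> L2 M"
  shows "(\<lambda>x. g x * f x) \<in> L2 M"
proof -
  obtain C where "AE x in M. \<bar>g x\<bar> \<le> C"
    using assms by (auto simp: Linf_sub_def)
  moreover have "g \<in> borel_measurable M"
    using assms measurable_from_subalg[OF subalg] by (auto simp: Linf_sub_def)
  ultimately show ?thesis
    using assms L2_mult_bounded by blast
qed

lemma Linf_sub_mult_L2_sub:
  assumes "g \<in> Linf_sub M F" "f \<in> L2_sub M F"
  shows "(\<lambda>x. g x * f x) \<in> L2_sub M F"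
  using assms Linf_sub_mult_L2[OF assms(1), of f] by (auto simp: L2_sub_def Linf_sub_def)

lemma L2_integrable: "f \<in> L2 M \<Longrightarrow> integrable M f"
  using L2_integrable_mult[of f M "\<lambda>x. 1"] L2_sub_L2[OF const_L2_sub] by simp

text \<open>The conditional expectation given \<open>F\<close> is an orthogonal projection: Jensen's inequality
  keeps it in \<open>L\<^sup>2\<close>, and its defining property is the orthogonality relation.\<close>

lemma real_cond_exp_L2_proj:
  assumes f: "f \<in> L2 M"
  shows "real_cond_exp M F f \<in> L2_sub M F"
    and "h \<in> L2_sub M F \<Longrightarrow> (\<integral>x. (f x - real_cond_exp M F f x) * h x \<partial>M) = 0"
proof -
  have "convex_on UNIV (\<lambda>x::real. x\<^sup>2)"
    using convex_power2 by simp
  then have "integrable M (\<lambda>x. (real_cond_exp M F f x)\<^sup>2)"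
    using L2_integrable[OF f] L2_integrable_square[OF f]
    by (intro integrable_convex_cond_exp[where I=UNIV and q="\<lambda>x. x\<^sup>2"]) auto
  then show *: "real_cond_exp M F f \<in> L2_sub M F"
    by (simp add: L2_sub_def L2_def)
  show "(\<integral>x. (f x - real_cond_exp M F f x) * h x \<partial>M) = 0" if h: "h \<in> L2_sub M F"
  proof -
    have int: "integrable M (\<lambda>x. h x * f x)"
      using L2_integrable_mult L2_sub_L2[OF h] f by blast
    have int': "integrable M (\<lambda>x. h x * real_cond_exp M F f x)"
      using L2_integrable_mult L2_sub_L2[OF h] L2_sub_L2[OF *] by blast
    have "(\<integral>x. h x * real_cond_exp M F f x \<partial>M) = (\<integral>x. h x * f x \<partial>M)"
      using int h L2_measurable[OF f] by (intro real_cond_exp_intg) (auto simp: L2_sub_def)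
    then show ?thesis
      using int int' by (simp add: right_diff_distrib mult.commute[of _ "h _"])
  qed
qed

lemma L2_proj_spec:
  assumes "f \<in> L2 M"
  shows "P f \<in> L2_sub M F \<and> (\<forall>h\<in>L2_sub M F. (\<integral>x. (f x - P f x) * h x \<partial>M) = 0)"
  unfolding L2_proj_def
  by (rule someI[of _ "real_cond_exp M F f"]) (use real_cond_exp_L2_proj[OF assms] in blast)

lemma L2_proj_L2_sub: "f \<in> L2 M \<Longrightarrow> P f \<in> L2_sub M F"
  using L2_proj_spec by blast

lemma L2_proj_L2: "f \<in> L2 M \<Longrightarrow> P f \<in> L2 M"
  using L2_proj_L2_sub L2_sub_L2 by blast

lemma L2_proj_measurable: "f \<in> L2 M \<Longrightarrow> P f \<in> borel_measurable M"
  using L2_proj_L2 L2_measurable by blast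

lemma L2_proj_inner:
  assumes f: "f \<in> L2 M" and h: "h \<in> L2_sub M F"
  shows "(\<integral>x. h x * P f x \<partial>M) = (\<integral>x. h x * f x \<partial>M)"
proof -
  have "(\<integral>x. (f x - P f x) * h x \<partial>M) = 0"
    using L2_proj_spec[OF f] h by blast
  moreover have "integrable M (\<lambda>x. h x * f x)" "integrable M (\<lambda>x. h x * P f x)"
    using L2_integrable_mult L2_sub_L2[OF h] f L2_proj_L2[OF f] by blast+
  ultimately show ?thesis
    by (simp add: right_diff_distrib mult.commute[of _ "h _"])
qed

lemma L2_proj_integral: "f \<in> L2 M \<Longrightarrow> (\<integral>x. P f x \<partial>M) = (\<integral>x. f x \<partial>M)"
  using L2_proj_inner[OF _ const_L2_sub, of f 1] by simp

text \<open>The difference of two candidates is itself an admissible test function. This is the tool for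
  identifying projections, which are pinned down only up to null sets.\<close>

lemma L2_proj_unique:
  assumes f: "f \<in> L2 M" and g: "g \<in> L2_sub M F"
    and orth: "\<And>h. h \<in> L2_sub M F \<Longrightarrow> (\<integral>x. h x * g x \<partial>M) = (\<integral>x. h x * f x \<partial>M)"
  shows "AE x in M. P f x = g x"
proof -
  define d where "d = (\<lambda>x. P f x - g x)"
  have d: "d \<in> L2_sub M F"
    unfolding d_def using L2_sub_diff[OF L2_proj_L2_sub[OF f] g] .
  have int: "integrable M (\<lambda>x. d x * P f x)" "integrable M (\<lambda>x. d x * g x)"
    using L2_integrable_mult L2_sub_L2[OF d] L2_sub_L2[OF g] L2_proj_L2[OF f] by blast+
  have "(\<integral>x. (d x)\<^sup>2 \<partial>M) = (\<integral>x. d x * P f x - d x * g x \<partial>M)"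
    by (simp add: d_def power2_eq_square right_diff_distrib)
  also have "\<dots> = 0"
    using L2_proj_inner[OF f d] orth[OF d] int by simp
  finally have "AE x in M. (d x)\<^sup>2 = 0"
    using L2_integrable_square[OF L2_sub_L2[OF d]] by (subst (asm) integral_nonneg_eq_0_iff_AE) auto
  then show ?thesis
    by (simp add: d_def)
qed

lemma L2_proj_cong_AE:
  assumes f: "f \<in> L2 M" and g: "g \<in> L2 M" and "AE x in M. f x = g x"
  shows "AE x in M. P f x = P g x"
proof (rule L2_proj_unique[OF f L2_proj_L2_sub[OF g]])
  fix h assume h: "h \<in> L2_sub M F"
  have "(\<integral>x. h x * g x \<partial>M) = (\<integral>x. h x * f x \<partial>M)"
    using assms L2_measurable[OF f] L2_measurable[OF g] L2_measurable[OF L2_sub_L2[OF h]]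
    by (intro integral_cong_AE) auto
  then show "(\<integral>x. h x * P g x \<partial>M) = (\<integral>x. h x * f x \<partial>M)"
    using L2_proj_inner[OF g h] by simp
qed

lemma L2_proj_cmult:
  assumes f: "f \<in> L2 M"
  shows "AE x in M. P (\<lambda>x. c * f x) x = c * P f x"
proof (rule L2_proj_unique[OF L2_cmult[OF f] L2_sub_cmult[OF L2_proj_L2_sub[OF f]]])
  fix h assume h: "h \<in> L2_sub M F"
  then show "(\<integral>x. h x * (c * P f x) \<partial>M) = (\<integral>x. h x * (c * f x) \<partial>M)"
    using L2_proj_inner[OF f h] by (simp add: mult.left_commute)
qed

lemma L2_proj_diff_const:
  assumes f: "f \<in> L2 M"
  shows "AE x in M. P (\<lambda>x. f x - c) x = P f x - c"
proof (rule L2_proj_unique)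
  show "(\<lambda>x. f x - c) \<in> L2 M"
    using L2_diff[OF f L2_sub_L2[OF const_L2_sub]] .
  show "(\<lambda>x. P f x - c) \<in> L2_sub M F"
    using L2_sub_diff[OF L2_proj_L2_sub[OF f] const_L2_sub] .
  fix h assume h: "h \<in> L2_sub M F"
  have "integrable M h" "integrable M (\<lambda>x. h x * f x)" "integrable M (\<lambda>x. h x * P f x)"
    using L2_integrable L2_integrable_mult L2_sub_L2[OF h] f L2_proj_L2[OF f] by blast+
  then show "(\<integral>x. h x * (P f x - c) \<partial>M) = (\<integral>x. h x * (f x - c) \<partial>M)"
    using L2_proj_inner[OF f h] by (simp add: right_diff_distrib)
qed

lemma L2_proj_mult:
  assumes g: "g \<in> Linf_sub M F" and f: "f \<in> L2 M"
  shows "AE x in M. P (\<lambda>x. g x * f x) x = g x * P f x"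
proof (rule L2_proj_unique[OF Linf_sub_mult_L2[OF g f]
      Linf_sub_mult_L2_sub[OF g L2_proj_L2_sub[OF f]]])
  fix h assume h: "h \<in> L2_sub M F"
  show "(\<integral>x. h x * (g x * P f x) \<partial>M) = (\<integral>x. h x * (g x * f x) \<partial>M)"
    using L2_proj_inner[OF f Linf_sub_mult_L2_sub[OF g h]] by (simp add: mult.assoc mult.left_commute)
qed

lemma L2_proj_L2_sub_eq: "f \<in> L2_sub M F \<Longrightarrow> AE x in M. P f x = f x"
  by (rule L2_proj_unique) (auto simp: L2_sub_L2)

lemma L2_proj_contraction:
  assumes f: "f \<in> L2 M"
  shows "L2_norm M (P f) \<le> L2_norm M f"
proof -
  have "(L2_norm M (P f))\<^sup>2 = (\<integral>x. P f x * f x \<partial>M)"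
    using L2_proj_inner[OF f L2_proj_L2_sub[OF f]]
    unfolding L2_norm_square by (simp add: power2_eq_square)
  also have "\<dots> \<le> L2_norm M (P f) * L2_norm M f"
    using L2_inner_le_norms[OF L2_proj_L2[OF f] f] .
  finally have *: "L2_norm M (P f) * L2_norm M (P f) \<le> L2_norm M (P f) * L2_norm M f"
    by (simp add: power2_eq_square)
  then show ?thesis
    using L2_norm_nonneg[of M "P f"] L2_norm_nonneg[of M f]
    by (cases "L2_norm M (P f) = 0") auto
qed

section \<open>The Koopman operator and the averaging operator\<close>

lemma S_pow_measurable: "(S ^^ k) \<in> measurable M M"
  using S_measurable by (rule measurable_compose_n)

lemma distr_S_pow: "distr M M (S ^^ k) = M"
proof (induction k)
  case 0
  then show ?case by (simp add: id_def)
next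
  case (Suc k)
  have "distr M M (S ^^ Suc k) = distr (distr M M (S ^^ k)) M S"
    using distr_distr[OF S_measurable S_pow_measurable[of k]] by simp
  then show ?case
    unfolding Suc S_invariant .
qed

lemma S_pow_integral:
  fixes f :: "'a \<Rightarrow> real"
  assumes "f \<in> borel_measurable M"
  shows "(\<integral>x. f ((S ^^ k) x) \<partial>M) = (\<integral>x. f x \<partial>M)"
  using integral_distr[OF S_pow_measurable assms, of k] distr_S_pow by simp

lemma S_pow_L2:
  assumes f: "f \<in> L2 M"
  shows "(\<lambda>x. f ((S ^^ k) x)) \<in> L2 M"
proof -
  have "integrable (distr M M (S ^^ k)) (\<lambda>x. (f x)\<^sup>2)"
    using L2_integrable_square[OF f] distr_S_pow by simp
  then have "integrable M (\<lambda>x. (f ((S ^^ k) x))\<^sup>2)"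
    using integrable_distr[OF S_pow_measurable] by blast
  then show ?thesis
    using L2_measurable[OF f] S_pow_measurable by (auto simp: L2_def)
qed

lemma koopman_L2: "f \<in> L2 M \<Longrightarrow> koopman S f \<in> L2 M"
  using S_pow_L2[of f 1] by (simp add: koopman_def comp_def)

lemma koopman_norm: "f \<in> L2 M \<Longrightarrow> L2_norm M (koopman S f) = L2_norm M f"
  using S_pow_integral[of "\<lambda>x. (f x)\<^sup>2" 1] L2_measurable[of f]
  by (simp add: L2_norm_def koopman_def)

lemma koopman_cong_AE:
  assumes "f \<in> L2 M" "g \<in> L2 M" "AE x in M. f x = g x"
  shows "AE x in M. koopman S f x = koopman S g x"
proof -
  have "AE x in distr M M S. f x = g x"
    unfolding S_invariant by (rule assms(3))
  then show ?thesis
    using AE_distrD[OF S_measurable] by (auto simp: koopman_def)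
qed

lemma averaging_op_L2: "f \<in> L2 M \<Longrightarrow> averaging_op M F S f \<in> L2 M"
  by (simp add: averaging_op_def L2_proj_L2 koopman_L2)

lemma averaging_op_contraction:
  assumes "f \<in> L2 M"
  shows "L2_norm M (averaging_op M F S f) \<le> L2_norm M f"
  unfolding averaging_op_def
  using L2_proj_contraction[OF koopman_L2[OF L2_proj_L2[OF assms]]]
    koopman_norm[OF L2_proj_L2[OF assms]] L2_proj_contraction[OF assms] by simp

lemma averaging_op_cmult:
  assumes f: "f \<in> L2 M"
  shows "AE x in M. averaging_op M F S (\<lambda>x. c * f x) x = c * averaging_op M F S f x"
proof -
  note Pf = L2_proj_L2[OF f]
  have "AE x in M. koopman S (P (\<lambda>x. c * f x)) x = koopman S (\<lambda>x. c * P f x) x"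
    by (intro koopman_cong_AE L2_proj_cmult L2_proj_L2 L2_cmult f)
  moreover have "koopman S (\<lambda>x. c * P f x) = (\<lambda>x. c * koopman S (P f) x)"
    by (auto simp: koopman_def)
  ultimately have "AE x in M. averaging_op M F S (\<lambda>x. c * f x) x
      = P (\<lambda>x. c * koopman S (P f) x) x"
    unfolding averaging_op_def
    by (intro L2_proj_cong_AE) (auto intro!: koopman_L2 L2_proj_L2 L2_cmult f)
  with L2_proj_cmult[OF koopman_L2[OF Pf], of c] show ?thesis
    unfolding averaging_op_def by eventually_elim simp
qed

lemma L2_sub0_iff: "f \<in> L2_sub0 M F \<longleftrightarrow> f \<in> L2_sub M F \<and> (\<integral>x. f x \<partial>M) = 0"
proof -
  have "(\<forall>c. (\<integral>x. f x * c \<partial>M) = 0) \<longleftrightarrow> (\<integral>x. f x \<partial>M) = 0"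
    by (auto dest: spec[of _ 1])
  then show ?thesis
    by (simp add: L2_sub0_def)
qed

text \<open>Boundedness of the set of norms, from contractivity, is what gives the supremum in
  \<open>averaging_norm0\<close> its meaning; functions of norm zero cannot be rescaled and are covered by
  contractivity as well.\<close>

lemma averaging_op_le_norm0:
  assumes f: "f \<in> L2_sub0 M F"
  shows "L2_norm M (averaging_op M F S f) \<le> averaging_norm0 M F S * L2_norm M f"
proof (cases "L2_norm M f = 0")
  case True
  then show ?thesis
    using averaging_op_contraction[of f] f by (simp add: L2_sub0_iff L2_sub_L2)
next
  case False
  define r where "r = L2_norm M f"
  have r: "0 < r"
    using False L2_norm_nonneg[of M f] by (simp add: r_def)
  have fL2: "f \<in> L2 M"
    using f by (simp add: L2_sub0_iff L2_sub_L2)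
  let ?A = "{L2_norm M (averaging_op M F S f) | f. f \<in> L2_sub0 M F \<and> L2_norm M f \<le> 1}"
  have "bdd_above ?A"
  proof (rule bdd_aboveI[of _ 1])
    fix a assume "a \<in> ?A"
    then obtain g where g: "a = L2_norm M (averaging_op M F S g)" "g \<in> L2_sub0 M F"
        "L2_norm M g \<le> 1"
      by blast
    then show "a \<le> 1"
      using averaging_op_contraction[of g] by (simp add: L2_sub0_iff L2_sub_L2)
  qed
  moreover have "L2_norm M (averaging_op M F S (\<lambda>x. inverse r * f x)) \<in> ?A"
  proof -
    have "(\<lambda>x. inverse r * f x) \<in> L2_sub0 M F"
      using f by (simp add: L2_sub0_iff L2_sub_cmult)
    moreover have "L2_norm M (\<lambda>x. inverse r * f x) \<le> 1"
      using r unfolding L2_norm_cmult by (simp add: r_def)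
    ultimately show ?thesis by blast
  qed
  ultimately have "L2_norm M (averaging_op M F S (\<lambda>x. inverse r * f x)) \<le> averaging_norm0 M F S"
    unfolding averaging_norm0_def by (rule cSup_upper[rotated])
  moreover have "L2_norm M (averaging_op M F S (\<lambda>x. inverse r * f x))
      = L2_norm M (\<lambda>x. inverse r * averaging_op M F S f x)"
    by (intro L2_norm_cong_AE averaging_op_cmult fL2 L2_measurable averaging_op_L2 L2_cmult)
  ultimately have "inverse r * L2_norm M (averaging_op M F S f) \<le> averaging_norm0 M F S"
    using r by (simp add: L2_norm_cmult)
  then show ?thesis
    using r by (simp add: r_def[symmetric] field_simps)
qed

end

section \<open>Decay along the subspace of property (M)\<close>

text \<open>The data of property (M), with the subspace fixed. The last assumption is a Markov property:
  the projected evolution of \<open>f\<close> depends on \<open>f\<close> only through \<open>P f\<close>.\<close>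

locale markov_subspace = state_factor M S F for M :: "'a measure" and S F +
  fixes V :: "('a \<Rightarrow> real) set"
  assumes closed_subspace: "closed_L2_subspace M V"
    and mult_closed: "\<And>g f. g \<in> Linf_sub M F \<Longrightarrow> f \<in> V \<Longrightarrow> (\<lambda>x. g x * f x) \<in> V"
    and koopman_closed: "\<And>f. f \<in> V \<Longrightarrow> koopman S f \<in> V"
    and L2_sub_subset: "L2_sub M F \<subseteq> V"
    and proj_koopman_proj:
      "\<And>f. f \<in> V \<Longrightarrow> AE x in M. P (koopman S (P f)) x = P (koopman S f) x"
begin

abbreviation lam :: real where
  "lam \<equiv> averaging_norm0 M F S"

lemma V_L2: "f \<in> V \<Longrightarrow> f \<in> L2 M"
  using closed_subspace by (auto simp: closed_L2_subspace_def)

lemma V_pow: "f \<in> V \<Longrightarrow> (\<lambda>x. f ((S ^^ k) x)) \<in> V"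
proof (induction k)
  case (Suc k)
  have "(\<lambda>x. f ((S ^^ Suc k) x)) = koopman S (\<lambda>x. f ((S ^^ k) x))"
    by (simp add: koopman_def comp_def funpow_Suc_right del: funpow.simps)
  then show ?case
    using koopman_closed Suc by simp
qed simp

lemma V_diff_const:
  assumes "f \<in> V"
  shows "(\<lambda>x. f x - c) \<in> V"
proof -
  have add: "\<forall>f\<in>V. \<forall>g\<in>V. (\<lambda>x. f x + g x) \<in> V"
    using closed_subspace by (simp add: closed_L2_subspace_def)
  have "(\<lambda>x. - c) \<in> V"
    using L2_sub_subset const_L2_sub by blast
  then have "(\<lambda>x. f x + - c) \<in> V"
    by (rule bspec[OF bspec[OF add assms]])
  then show ?thesis
    by simp
qed

lemma averaging_op_proj:
  assumes f: "f \<in> V"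
  shows "AE x in M. averaging_op M F S (P f) x = P (koopman S f) x"
proof -
  have "P f \<in> V"
    using f L2_proj_L2_sub V_L2 L2_sub_subset by blast
  from proj_koopman_proj[OF this] proj_koopman_proj[OF f] show ?thesis
    unfolding averaging_op_def by eventually_elim simp
qed

text \<open>By the Markov property each further application of \<open>U\<close> acts on the projection as the averaging
  operator, which costs one factor \<open>lam\<close>. Invariance of the measure keeps all the intermediate
  functions mean-zero.\<close>

lemma proj_pow_decay:
  assumes f: "f \<in> V" and mean: "(\<integral>x. f x \<partial>M) = 0" and lam: "0 \<le> lam"
  shows "L2_norm M (P (\<lambda>x. f ((S ^^ k) x))) \<le> lam ^ k * L2_norm M (P f)"
proof (induction k)
  case (Suc k)
  define u where "u = (\<lambda>x. f ((S ^^ k) x))"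
  have u: "u \<in> V"
    unfolding u_def using V_pow[OF f] .
  have "(\<lambda>x. f ((S ^^ Suc k) x)) = koopman S u"
    by (simp add: u_def koopman_def comp_def funpow_Suc_right del: funpow.simps)
  then have "L2_norm M (P (\<lambda>x. f ((S ^^ Suc k) x))) = L2_norm M (averaging_op M F S (P u))"
    using averaging_op_proj[OF u] V_L2[OF u]
    by (auto intro!: L2_norm_cong_AE L2_measurable L2_proj_L2 koopman_L2 averaging_op_L2)
  also have "\<dots> \<le> lam * L2_norm M (P u)"
  proof (rule averaging_op_le_norm0)
    have "(\<integral>x. u x \<partial>M) = 0"
      using S_pow_integral[OF L2_measurable[OF V_L2[OF f]]] mean by (simp add: u_def)
    then show "P u \<in> L2_sub0 M F"
      using L2_proj_integral[OF V_L2[OF u]] L2_proj_L2_sub[OF V_L2[OF u]]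
      by (simp add: L2_sub0_iff)
  qed
  also have "\<dots> \<le> lam * (lam ^ k * L2_norm M (P f))"
    using Suc lam by (intro mult_left_mono) (auto simp: u_def)
  finally show ?case
    by (simp add: mult.assoc)
qed simp

section \<open>Exponential moments\<close>

text \<open>The quadratic form of the operator \<open>a \<mapsto> (1 - \<theta>) m(a) + \<theta> a\<close>, the transition operator of the
  chain that is refreshed from the stationary law with probability \<open>1 - \<theta>\<close> and otherwise rests.\<close>

definition energy :: "real \<Rightarrow> ('a \<Rightarrow> real) \<Rightarrow> real" where
  "energy \<theta> a = (1 - \<theta>) * (\<integral>x. a x \<partial>M)\<^sup>2 + \<theta> * (\<integral>x. (a x)\<^sup>2 \<partial>M)"

lemma energy_cong_AE:
  assumes "f \<in> borel_measurable M" "g \<in> borel_measurable M" "AE x in M. f x = g x"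
  shows "energy \<theta> f = energy \<theta> g"
proof -
  have "(\<integral>x. f x \<partial>M) = (\<integral>x. g x \<partial>M)" "(\<integral>x. (f x)\<^sup>2 \<partial>M) = (\<integral>x. (g x)\<^sup>2 \<partial>M)"
    using assms by (auto intro!: integral_cong_AE)
  then show ?thesis
    by (simp add: energy_def)
qed

lemma centered_norm_square:
  assumes "f \<in> L2 M" "c = (\<integral>x. f x \<partial>M)"
  shows "(L2_norm M (\<lambda>x. f x - c))\<^sup>2 = (\<integral>x. (f x)\<^sup>2 \<partial>M) - c\<^sup>2"
  using variance_eq[OF L2_integrable[OF assms(1)] L2_integrable_square[OF assms(1)]]
  by (simp add: L2_norm_square assms(2))

text \<open>Split \<open>a\<close> and \<open>f\<close> into their means \<open>\<alpha>\<close>, \<open>\<beta>\<close> and centred parts. The cross terms vanish, the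
  means contribute \<open>\<alpha> \<beta>\<close>, and the centred parts at most \<open>\<theta> p q\<close>, where \<open>p\<close> and \<open>q\<close> are the norms
  of the centred parts of \<open>a\<close> and \<open>P f\<close>. The claim is then the Cauchy-Schwarz inequality for the
  vectors \<open>(\<alpha>, \<surd>\<theta> p)\<close> and \<open>(\<beta>, \<surd>\<theta> q)\<close>.\<close>

lemma transition_form_bound:
  assumes a: "a \<in> L2_sub M F" and f: "f \<in> V" and lam: "0 \<le> lam"
  shows "(\<integral>x. a x * P (\<lambda>y. f ((S ^^ k) y)) x \<partial>M)
           \<le> sqrt (energy (lam ^ k) a * energy (lam ^ k) (P f))"
proof -
  define \<theta> where "\<theta> = lam ^ k"
  define \<alpha> where "\<alpha> = (\<integral>x. a x \<partial>M)"
  define \<beta> where "\<beta> = (\<integral>x. f x \<partial>M)"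
  define a0 where "a0 = (\<lambda>x. a x - \<alpha>)"
  define f0 where "f0 = (\<lambda>x. f x - \<beta>)"
  define U where "U = (\<lambda>(h :: 'a \<Rightarrow> real) x. h ((S ^^ k) x))"
  have \<theta>: "0 \<le> \<theta>"
    using lam by (simp add: \<theta>_def)
  have fL2: "f \<in> L2 M" and f0: "f0 \<in> V"
    using V_L2[OF f] V_diff_const[OF f] by (auto simp: f0_def)
  have f0L2: "f0 \<in> L2 M"
    using V_L2[OF f0] .
  have a0: "a0 \<in> L2_sub M F"
    unfolding a0_def using L2_sub_diff[OF a const_L2_sub] .
  note aL2 = L2_sub_L2[OF a] and a0L2 = L2_sub_L2[OF a0]
  have UL2: "U h \<in> L2 M" if "h \<in> L2 M" for h
    unfolding U_def using S_pow_L2[OF that] .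
  have Uint: "(\<integral>x. U h x \<partial>M) = (\<integral>x. h x \<partial>M)" if "h \<in> L2 M" for h
    unfolding U_def using S_pow_integral[OF L2_measurable[OF that]] .
  have int_a0: "(\<integral>x. a0 x \<partial>M) = 0"
    using L2_integrable[OF aL2] by (simp add: a0_def \<alpha>_def prob_space)
  have int_f0: "(\<integral>x. f0 x \<partial>M) = 0"
    using L2_integrable[OF fL2] by (simp add: f0_def \<beta>_def prob_space)
  have "(\<integral>x. a x * P (U f) x \<partial>M) = (\<integral>x. a x * U f x \<partial>M)"
    using L2_proj_inner[OF UL2[OF fL2] a] .
  also have "\<dots> = (\<integral>x. a0 x * U f0 x + \<beta> * a0 x + \<alpha> * U f x \<partial>M)"
    by (rule arg_cong[where f="integral\<^sup>L M"])
      (auto simp: a0_def f0_def U_def algebra_simps)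
  also have "\<dots> = (\<integral>x. a0 x * U f0 x \<partial>M) + \<alpha> * \<beta>"
    using L2_integrable_mult[OF a0L2 UL2[OF f0L2]] L2_integrable[OF a0L2]
      L2_integrable[OF UL2[OF fL2]] Uint[OF fL2] int_a0 by (simp add: \<beta>_def)
  also have "(\<integral>x. a0 x * U f0 x \<partial>M) = (\<integral>x. a0 x * P (U f0) x \<partial>M)"
    using L2_proj_inner[OF UL2[OF f0L2] a0] by simp
  also have "\<dots> \<le> L2_norm M a0 * L2_norm M (P (U f0))"
    by (intro L2_inner_le_norms a0L2 L2_proj_L2 UL2 f0L2)
  also have "\<dots> \<le> L2_norm M a0 * (\<theta> * L2_norm M (P f0))"
    unfolding U_def \<theta>_def
    by (intro mult_left_mono proj_pow_decay f0 int_f0 lam L2_norm_nonneg)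
  finally have le: "(\<integral>x. a x * P (U f) x \<partial>M)
      \<le> L2_norm M a0 * (\<theta> * L2_norm M (P f0)) + \<alpha> * \<beta>"
    by simp
  define p where "p = L2_norm M a0"
  define q where "q = L2_norm M (P f0)"
  have p2: "p\<^sup>2 = (\<integral>x. (a x)\<^sup>2 \<partial>M) - \<alpha>\<^sup>2"
    unfolding p_def a0_def using centered_norm_square[OF aL2 \<alpha>_def] .
  have "q = L2_norm M (\<lambda>x. P f x - \<beta>)"
    unfolding q_def f0_def
    using L2_proj_measurable[OF f0L2] L2_proj_measurable[OF fL2]
    by (intro L2_norm_cong_AE L2_proj_diff_const fL2) (simp_all add: f0_def)
  then have q2: "q\<^sup>2 = (\<integral>x. (P f x)\<^sup>2 \<partial>M) - \<beta>\<^sup>2"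
    using centered_norm_square[OF L2_proj_L2[OF fL2]] L2_proj_integral[OF fL2]
    by (simp add: \<beta>_def)
  have Qa: "energy \<theta> a = \<alpha>\<^sup>2 + \<theta> * p\<^sup>2"
    unfolding energy_def p2 \<alpha>_def[symmetric] by (simp add: algebra_simps)
  have Qf: "energy \<theta> (P f) = \<beta>\<^sup>2 + \<theta> * q\<^sup>2"
    unfolding energy_def q2 L2_proj_integral[OF fL2] \<beta>_def[symmetric] by (simp add: algebra_simps)
  \<comment> \<open>Lagrange's identity: the difference of the two sides of the next inequality.\<close>
  have "0 \<le> \<theta> * (\<alpha> * q - \<beta> * p)\<^sup>2"
    using \<theta> by simp
  then have "(\<alpha> * \<beta> + \<theta> * p * q)\<^sup>2 \<le> energy \<theta> a * energy \<theta> (P f)"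
    unfolding Qa Qf by (simp add: power2_eq_square algebra_simps)
  then have "\<alpha> * \<beta> + \<theta> * p * q \<le> sqrt (energy \<theta> a * energy \<theta> (P f))"
    by (rule real_le_rsqrt)
  with le show ?thesis
    by (simp add: U_def \<theta>_def p_def q_def algebra_simps)
qed

lemma weighted_Cauchy_Schwarz:
  assumes g: "g \<in> borel_measurable M" "\<And>x. x \<in> space M \<Longrightarrow> 0 \<le> g x \<and> g x \<le> B"
    and v: "v \<in> L2 M"
  shows "(\<integral>x. g x * v x \<partial>M)\<^sup>2 \<le> (\<integral>x. g x \<partial>M) * (\<integral>x. g x * (v x)\<^sup>2 \<partial>M)"
proof -
  have m: "(\<lambda>x. sqrt (g x)) \<in> borel_measurable M"
    using g by simp
  have b: "AE x in M. \<bar>sqrt (g x)\<bar> \<le> sqrt B"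
    using g by (intro AE_I2) simp
  have s1: "(\<lambda>x. sqrt (g x)) \<in> L2 M"
    using L2_mult_bounded[OF L2_sub_L2[OF const_L2_sub[of 1]] m b] by simp
  have s2: "(\<lambda>x. sqrt (g x) * v x) \<in> L2 M"
    using L2_mult_bounded[OF v m b] .
  have "(\<integral>x. sqrt (g x) * (sqrt (g x) * v x) \<partial>M) = (\<integral>x. g x * v x \<partial>M)"
    "(\<integral>x. (sqrt (g x))\<^sup>2 \<partial>M) = (\<integral>x. g x \<partial>M)"
    "(\<integral>x. (sqrt (g x) * v x)\<^sup>2 \<partial>M) = (\<integral>x. g x * (v x)\<^sup>2 \<partial>M)"
    using g(2) by (auto intro!: Bochner_Integration.integral_cong
        simp: power_mult_distrib mult.assoc[symmetric])
  then show ?thesis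
    using L2_Cauchy_Schwarz[OF s1 s2] by simp
qed

text \<open>The partial products obey \<open>f (j + 1) = g (U\<^sup>k (f j))\<close>, so \<open>v j = P (U\<^sup>k (f j))\<close> evolves by the
  projected dynamics and \<open>P (f (j + 1)) = g (v j)\<close>. Following the weighted norms
  \<open>E j = \<integral> g (v j)\<^sup>2\<close> instead of the integrals of \<open>f j\<close> amounts to iterating the symmetrised operator
  \<open>\<surd>g T\<^sup>k \<surd>g\<close>, whose norm is at most \<open>\<rho>\<close>; so \<open>E\<close> grows by a factor \<open>\<rho>\<^sup>2\<close> at most. Both ends of the
  product contribute \<open>m(g) \<le> \<rho>\<close>, which makes the exponent exactly \<open>j\<close>.\<close>

lemma multiplicative_moment_bound:
  fixes g :: "'a \<Rightarrow> real"
  assumes gF: "g \<in> borel_measurable F" and g: "\<And>x. x \<in> space M \<Longrightarrow> 0 \<le> g x \<and> g x \<le> B"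
    and lam: "0 \<le> lam" "lam ^ k \<le> 1"
  shows "(\<integral>x. (\<Prod>i<j. g ((S ^^ (k * i)) x)) \<partial>M)
           \<le> ((1 - lam ^ k) * (\<integral>x. g x \<partial>M) + lam ^ k * B) ^ j"
proof -
  define \<theta> where "\<theta> = lam ^ k"
  define \<rho> where "\<rho> = (1 - \<theta>) * (\<integral>x. g x \<partial>M) + \<theta> * B"
  define f where "f = (\<lambda>j x. \<Prod>i<j. g ((S ^^ (k * i)) x))"
  define v where "v = (\<lambda>j. P (\<lambda>x. f j ((S ^^ k) x)))"
  define E where "E = (\<lambda>j. \<integral>x. g x * (v j x)\<^sup>2 \<partial>M)"
  have \<theta>: "0 \<le> \<theta>" "\<theta> \<le> 1"
    using lam by (auto simp: \<theta>_def)
  have gM: "g \<in> borel_measurable M"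
    using measurable_from_subalg[OF subalg gF] .
  have "AE x in M. \<bar>g x\<bar> \<le> B"
    using g by (intro AE_I2) simp
  then have gLinf: "g \<in> Linf_sub M F"
    using gF by (auto simp: Linf_sub_def)
  have gint: "integrable M g"
    using L2_integrable[OF Linf_sub_mult_L2[OF gLinf L2_sub_L2[OF const_L2_sub[of 1]]]] by simp
  have g_nonneg: "0 \<le> (\<integral>x. g x \<partial>M)"
    using g by (intro Bochner_Integration.integral_nonneg) auto
  have "(\<integral>x. g x \<partial>M) \<le> B"
    using integral_mono[OF gint, of "\<lambda>_. B"] g prob_space by simp
  then have mean_le: "(\<integral>x. g x \<partial>M) \<le> \<rho>"
    using mult_left_mono[OF _ \<theta>(1), of "\<integral>x. g x \<partial>M" B] by (simp add: \<rho>_def algebra_simps)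
  then have \<rho>: "0 \<le> \<rho>"
    using g_nonneg by simp
  have f_Suc: "f (Suc j) = (\<lambda>x. g x * f j ((S ^^ k) x))" for j
  proof
    fix x
    have "(S ^^ (k * Suc i)) x = (S ^^ (k * i)) ((S ^^ k) x)" for i
      by (metis add.commute comp_apply funpow_add mult_Suc_right)
    then show "f (Suc j) x = g x * f j ((S ^^ k) x)"
      unfolding f_def by (simp add: prod.lessThan_Suc_shift del: prod.lessThan_Suc mult_Suc_right)
  qed
  have fV: "f j \<in> V" for j
  proof (induction j)
    case 0
    then show ?case
      using const_L2_sub[of 1] L2_sub_subset by (auto simp: f_def)
  next
    case (Suc j)
    then show ?case
      unfolding f_Suc by (intro mult_closed gLinf V_pow)
  qed
  have vL2: "v j \<in> L2_sub M F" for j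
    unfolding v_def by (intro L2_proj_L2_sub V_L2 V_pow fV)
  have Pf: "AE x in M. P (f (Suc j)) x = g x * v j x" for j
    unfolding f_Suc v_def by (intro L2_proj_mult gLinf V_L2 V_pow fV)
  note gv = Linf_sub_mult_L2_sub[OF gLinf vL2]
  have gv_M: "(\<lambda>x. g x * v j x) \<in> borel_measurable M" for j
    using L2_measurable[OF L2_sub_L2[OF gv]] .
  have Pf_M: "P (f j) \<in> borel_measurable M" for j
    by (intro L2_proj_measurable V_L2 fV)
  have E_nonneg: "0 \<le> E j" for j
    unfolding E_def using g by (intro Bochner_Integration.integral_nonneg) auto
  have CS: "(\<integral>x. g x * v j x \<partial>M)\<^sup>2 \<le> (\<integral>x. g x \<partial>M) * E j" for j
    unfolding E_def using weighted_Cauchy_Schwarz[OF gM g L2_sub_L2[OF vL2]] .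
  \<comment> \<open>The mean part of the energy is controlled by Cauchy-Schwarz with weight \<open>g\<close>, the rest by \<open>g \<le> B\<close>.\<close>
  have energy_le: "energy \<theta> (\<lambda>x. g x * v j x) \<le> \<rho> * E j" for j
  proof -
    have int: "integrable M (\<lambda>x. (v j x) * (g x * v j x))"
      by (intro L2_integrable_mult L2_sub_L2 vL2 gv)
    have "(\<integral>x. (g x * v j x)\<^sup>2 \<partial>M) \<le> (\<integral>x. B * (g x * (v j x)\<^sup>2) \<partial>M)"
    proof (rule integral_mono)
      show "integrable M (\<lambda>x. (g x * v j x)\<^sup>2)"
        by (intro L2_integrable_square L2_sub_L2 gv)
      show "integrable M (\<lambda>x. B * (g x * (v j x)\<^sup>2))"
        using int by (simp add: power2_eq_square mult.left_commute)
      fix x assume "x \<in> space M"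
      then have "g x * (g x * (v j x)\<^sup>2) \<le> B * (g x * (v j x)\<^sup>2)"
        using g by (intro mult_right_mono) auto
      then show "(g x * v j x)\<^sup>2 \<le> B * (g x * (v j x)\<^sup>2)"
        by (simp add: power2_eq_square mult_ac)
    qed
    then have "(\<integral>x. (g x * v j x)\<^sup>2 \<partial>M) \<le> B * E j"
      by (simp add: E_def)
    then have "energy \<theta> (\<lambda>x. g x * v j x)
        \<le> (1 - \<theta>) * ((\<integral>x. g x \<partial>M) * E j) + \<theta> * (B * E j)"
      unfolding energy_def using CS[of j] \<theta> by (intro add_mono mult_left_mono) auto
    then show ?thesis
      by (simp add: \<rho>_def algebra_simps)
  qed
  \<comment> \<open>Pairing \<open>v (j + 1)\<close> with itself through the form bound gives \<open>E (j + 1)\<^sup>2 \<le> \<rho>\<^sup>2 E (j + 1) E j\<close>.\<close>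
  have E_Suc: "E (Suc j) \<le> \<rho>\<^sup>2 * E j" for j
  proof -
    have "E (Suc j) = (\<integral>x. (g x * v (Suc j) x) * P (\<lambda>y. f (Suc j) ((S ^^ k) y)) x \<partial>M)"
      by (simp add: E_def v_def power2_eq_square mult.assoc)
    also have "\<dots> \<le> sqrt (energy \<theta> (\<lambda>x. g x * v (Suc j) x) * energy \<theta> (P (f (Suc j))))"
      unfolding \<theta>_def by (intro transition_form_bound gv fV lam)
    also have "energy \<theta> (P (f (Suc j))) = energy \<theta> (\<lambda>x. g x * v j x)"
      by (intro energy_cong_AE Pf Pf_M gv_M)
    also have "sqrt (energy \<theta> (\<lambda>x. g x * v (Suc j) x) * energy \<theta> (\<lambda>x. g x * v j x))
        \<le> sqrt ((\<rho> * E (Suc j)) * (\<rho> * E j))"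
      using energy_le \<theta> \<rho> E_nonneg
      by (intro real_sqrt_le_mono mult_mono) (auto simp: energy_def)
    finally have "(E (Suc j))\<^sup>2 \<le> (sqrt ((\<rho> * E (Suc j)) * (\<rho> * E j)))\<^sup>2"
      using E_nonneg by (rule power_mono)
    also have "\<dots> = (\<rho> * E (Suc j)) * (\<rho> * E j)"
      using E_nonneg \<rho> by simp
    finally have "E (Suc j) * E (Suc j) \<le> (\<rho> * E (Suc j)) * (\<rho> * E j)"
      unfolding power2_eq_square .
    then have "E (Suc j) * E (Suc j) \<le> E (Suc j) * (\<rho>\<^sup>2 * E j)"
      by (simp add: power2_eq_square mult_ac)
    then show ?thesis
      using E_nonneg[of "Suc j"] E_nonneg[of j] \<rho> by (cases "E (Suc j) = 0") auto
  qed
  have E_le: "E j \<le> \<rho> ^ (2 * j + 1)" for j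
  proof (induction j)
    case 0
    have "AE x in M. v 0 x = 1"
      using L2_proj_L2_sub_eq[OF const_L2_sub[of 1]] by (simp add: v_def f_def)
    then have "E 0 = (\<integral>x. g x \<partial>M)"
      unfolding E_def using gM L2_measurable[OF L2_sub_L2[OF vL2]]
      by (intro integral_cong_AE) auto
    then show ?case
      using mean_le by simp
  next
    case (Suc j)
    have "E (Suc j) \<le> \<rho>\<^sup>2 * \<rho> ^ (2 * j + 1)"
      using E_Suc[of j] mult_left_mono[OF Suc, of "\<rho>\<^sup>2"] by simp
    then show ?case
      by (simp add: power2_eq_square mult_ac)
  qed
  have "(\<integral>x. f j x \<partial>M) \<le> \<rho> ^ j"
  proof (cases j)
    case 0
    then show ?thesis
      by (simp add: f_def prob_space)
  next
    case (Suc i)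
    have "(\<integral>x. f j x \<partial>M) = (\<integral>x. P (f (Suc i)) x \<partial>M)"
      using L2_proj_integral[OF V_L2[OF fV]] Suc by simp
    also have "\<dots> = (\<integral>x. g x * v i x \<partial>M)"
      by (intro integral_cong_AE Pf Pf_M gv_M)
    finally have "(\<integral>x. f j x \<partial>M)\<^sup>2 \<le> (\<integral>x. g x \<partial>M) * E i"
      using CS by simp
    also have "\<dots> \<le> \<rho> * \<rho> ^ (2 * i + 1)"
      using mean_le E_le[of i] \<rho> E_nonneg by (intro mult_mono) auto
    also have "\<dots> = (\<rho> ^ j)\<^sup>2"
      using power_even_eq[of \<rho> "Suc i"] by (simp add: Suc)
    finally show ?thesis
      using \<rho> by (meson power2_le_imp_le zero_le_power)
  qed
  then show ?thesis
    by (simp add: f_def \<rho>_def \<theta>_def)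
qed

end

section \<open>Binary divergence and Chernoff's optimisation\<close>

text \<open>The finite values of \<open>KL_binary\<close>. The formula stays correct at \<open>a = 0\<close> and \<open>a = 1\<close>, where the
  undefined quotient is multiplied by \<open>0\<close>.\<close>

definition bin_div :: "real \<Rightarrow> real \<Rightarrow> real" where
  "bin_div a b = - a * ln (b / a) - (1 - a) * ln ((1 - b) / (1 - a))"

lemma KL_binary_eq_bin_div: "0 < b \<Longrightarrow> b < 1 \<Longrightarrow> KL_binary a b = ereal (bin_div a b)"
  by (simp add: KL_binary_def bin_div_def)

lemma KL_binary_complement: "KL_binary (1 - a) (1 - b) = KL_binary a b"
  by (auto simp: KL_binary_def left_diff_distrib)

lemma exp_ereal_infinity: "exp_ereal \<infinity> = \<infinity>"
  unfolding exp_ereal_def infinity_ereal_def by (simp only: ereal.case)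

text \<open>The divergence from \<open>\<eta>\<close> increases as the second argument moves away from \<open>\<eta>\<close> to the left.
  The inequality \<open>ln x \<le> x - 1\<close>, applied to both logarithms of the difference, leaves the term
  \<open>(p - q) (p - \<eta>) / (p (1 - p))\<close>, of manifest sign.\<close>

lemma bin_div_mono:
  assumes "0 < q" "q \<le> p" "p < 1" "p \<le> \<eta>" "\<eta> \<le> 1"
  shows "bin_div \<eta> p \<le> bin_div \<eta> q"
proof -
  have "bin_div \<eta> p - bin_div \<eta> q = \<eta> * ln (q / p) + (1 - \<eta>) * ln ((1 - q) / (1 - p))"
    using assms by (cases "\<eta> = 1") (auto simp: bin_div_def ln_div algebra_simps)
  also have "\<dots> \<le> \<eta> * (q / p - 1) + (1 - \<eta>) * ((1 - q) / (1 - p) - 1)"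
    using assms by (intro add_mono mult_left_mono ln_le_minus_one) auto
  also have "\<dots> = (p - q) * (p - \<eta>) / (p * (1 - p))"
    using assms by (simp add: field_simps)
  also have "\<dots> \<le> 0"
    using assms by (intro divide_nonpos_nonneg mult_nonneg_nonpos) auto
  finally show ?thesis
    by simp
qed

lemma bin_div_nonneg:
  assumes "0 < p" "p < 1" "p \<le> \<eta>" "\<eta> \<le> 1"
  shows "0 \<le> bin_div \<eta> p"
proof (cases "\<eta> = 1")
  case True
  then show ?thesis
    using assms by (simp add: bin_div_def)
next
  case False
  then have "bin_div \<eta> \<eta> \<le> bin_div \<eta> p"
    using assms by (intro bin_div_mono) auto
  then show ?thesis
    using assms False by (simp add: bin_div_def)
qed

text \<open>The infimum over \<open>t \<ge> 0\<close> of \<open>exp (- t \<eta>) (1 - p + p exp t)\<close> is \<open>exp (- D(\<eta> \<parallel> p))\<close>. For \<open>\<eta> < 1\<close> it is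
  attained where the tilted Bernoulli law has mean \<open>\<eta>\<close>, at
  \<open>exp t = \<eta> (1 - p) / (p (1 - \<eta>))\<close>, and \<open>p \<le> \<eta>\<close> makes this \<open>t\<close> nonnegative. For \<open>\<eta> = 1\<close> it is only
  approached, as \<open>t\<close> tends to infinity.\<close>

lemma bernoulli_Chernoff:
  assumes p: "0 < p" "p < 1" and \<eta>: "p \<le> \<eta>" "\<eta> \<le> 1"
    and bound: "\<And>t. 0 \<le> t \<Longrightarrow> x \<le> (exp (- (t * \<eta>)) * (1 - p + p * exp t)) ^ j"
  shows "x \<le> exp (- (real j * bin_div \<eta> p))"
proof (cases "\<eta> = 1")
  case True
  have "((\<lambda>t. (exp (- t) * (1 - p + p * exp t)) ^ j) \<longlongrightarrow> p ^ j) at_top"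
  proof (intro tendsto_power)
    have "((\<lambda>t. exp (- t) * (1 - p) + p) \<longlongrightarrow> 0 * (1 - p) + p) at_top"
      by (intro tendsto_intros filterlim_compose[OF exp_at_bot] filterlim_uminus_at_bot_at_top)
    moreover have "exp (- t) * (1 - p + p * exp t) = exp (- t) * (1 - p) + p" for t :: real
      by (simp add: exp_minus field_simps)
    ultimately show "((\<lambda>t. exp (- t) * (1 - p + p * exp t)) \<longlongrightarrow> p) at_top"
      by simp
  qed
  moreover have "eventually (\<lambda>t. x \<le> (exp (- t) * (1 - p + p * exp t)) ^ j) at_top"
    using eventually_ge_at_top[of "0::real"] by eventually_elim (use bound True in simp)
  ultimately have "x \<le> p ^ j"
    by (rule tendsto_lowerbound) simp
  also have "p ^ j = exp (- (real j * bin_div \<eta> p))"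
    using p True by (simp add: bin_div_def exp_of_nat_mult)
  finally show ?thesis .
next
  case False
  then have \<eta>1: "\<eta> < 1" using \<eta> by simp
  define t where "t = ln (\<eta> / p) + ln ((1 - p) / (1 - \<eta>))"
  have "0 \<le> t"
    using p \<eta> \<eta>1 by (simp add: t_def)
  have "exp t = (\<eta> / p) * ((1 - p) / (1 - \<eta>))"
    using p \<eta> \<eta>1 by (simp add: t_def exp_add)
  then have "1 - p + p * exp t = (1 - p) / (1 - \<eta>)"
    using p \<eta>1 by (simp add: field_simps)
  also have "\<dots> = exp (ln ((1 - p) / (1 - \<eta>)))"
    using p \<eta>1 by simp
  finally have "exp (- (t * \<eta>)) * (1 - p + p * exp t)
      = exp (- (t * \<eta>) + ln ((1 - p) / (1 - \<eta>)))"
    by (simp only: exp_add)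
  also have "- (t * \<eta>) + ln ((1 - p) / (1 - \<eta>)) = - bin_div \<eta> p"
    using p \<eta> \<eta>1 by (simp add: t_def bin_div_def ln_div algebra_simps)
  finally have "x \<le> exp (- bin_div \<eta> p) ^ j"
    using bound[OF \<open>0 \<le> t\<close>] by simp
  then show ?thesis
    by (simp flip: exp_of_nat_mult)
qed

section \<open>Splitting into residue classes\<close>

text \<open>The class of \<open>r\<close> modulo \<open>k\<close> in \<open>{..<n}\<close> is \<open>{r + k j | j < \<lceil>(n - r) / k\<rceil>}\<close>. For \<open>n \<le> r\<close> the truncated
  difference is \<open>0\<close>, and so is the quotient.\<close>

lemma sum_residue_classes:
  fixes h :: "nat \<Rightarrow> real"
  assumes k: "k \<ge> 1"
  shows "(\<Sum>i<n. h i) = (\<Sum>r<k. \<Sum>j<(n - r + k - 1) div k. h (r + k * j))"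
proof -
  have mem: "j < (n - r + k - 1) div k \<longleftrightarrow> r + k * j < n" for j r
  proof -
    have "j < (n - r + k - 1) div k \<longleftrightarrow> Suc j * k \<le> n - r + k - 1"
      using k by (simp add: Suc_le_eq[symmetric] less_eq_div_iff_mult_less_eq)
    also have "\<dots> \<longleftrightarrow> r + k * j < n"
      using k by (simp add: algebra_simps) linarith
    finally show ?thesis .
  qed
  have "(\<Sum>r<k. \<Sum>j<(n - r + k - 1) div k. h (r + k * j))
      = (\<Sum>(r, j)\<in>(SIGMA r:{..<k}. {..<(n - r + k - 1) div k}). h (r + k * j))"
    by (subst sum.Sigma) auto
  also have "\<dots> = (\<Sum>i<n. h i)"
    by (rule sum.reindex_bij_witness[of _ "\<lambda>i. (i mod k, i div k)" "\<lambda>(r, j). r + k * j"])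
      (use k mem in \<open>auto simp: mem\<close>)
  finally show ?thesis
    by simp
qed

lemma residue_class_size:
  assumes "k \<ge> 1" "r < k"
  shows "real n / real k - 1 \<le> real ((n - r + k - 1) div k)"
proof -
  have "n \<le> k * ((n - r + k - 1) div k) + k"
  proof -
    define m where "m = n - r + k - 1"
    have "k * (m div k) + m mod k = m" "m mod k < k"
      using assms by auto
    moreover have "n + k \<le> m + r + 1"
      using assms by (simp add: m_def)
    ultimately show ?thesis
      using assms(2) unfolding m_def[symmetric] by linarith
  qed
  then have "real n \<le> real k * real ((n - r + k - 1) div k) + real k"
    by (metis of_nat_add of_nat_le_iff of_nat_mult)
  then show ?thesis
    using assms by (simp add: field_simps)
qed

text \<open>The full sum minus \<open>n \<eta>\<close> is the sum of the same excesses over the classes, so these are not all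
  negative. An empty class has excess \<open>0\<close> and is a legitimate witness.\<close>

lemma exists_residue_class_ge:
  fixes h :: "nat \<Rightarrow> real"
  assumes k: "k \<ge> 1" and le: "real n * \<eta> \<le> (\<Sum>i<n. h i)"
  shows "\<exists>r<k. real ((n - r + k - 1) div k) * \<eta> \<le> (\<Sum>j<(n - r + k - 1) div k. h (r + k * j))"
proof (rule ccontr)
  assume "\<not> ?thesis"
  then have "(\<Sum>r<k. \<Sum>j<(n - r + k - 1) div k. h (r + k * j))
      < (\<Sum>r<k. real ((n - r + k - 1) div k) * \<eta>)"
    using k by (intro sum_strict_mono) (auto simp: not_le lessThan_empty_iff)
  moreover have "(\<Sum>r<k. real ((n - r + k - 1) div k) * \<eta>) = real n * \<eta>"
    using sum_residue_classes[OF k, where h="\<lambda>_. \<eta>" and n=n] by simp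
  ultimately show False
    using le sum_residue_classes[OF k, where h=h and n=n] by simp
qed

section \<open>Tail bounds for the state process\<close>

context markov_subspace
begin

text \<open>The exponential Markov inequality, with the chord of \<open>exp\<close> over \<open>[0, t]\<close> estimating the mean of
  the weight \<open>exp (t \<phi>)\<close>. Linearity in \<open>\<mu>\<close> turns the mixture with weights \<open>1 - \<theta>\<close> and \<open>\<theta>\<close> into
  a Bernoulli moment generating function with the shifted parameter \<open>p\<close>.\<close>

lemma progression_tail:
  fixes \<phi> :: "'a \<Rightarrow> real"
  assumes \<phi>F: "\<phi> \<in> borel_measurable F" and \<phi>: "\<And>x. x \<in> space M \<Longrightarrow> \<phi> x \<in> {0..1}"
    and lam: "0 \<le> lam" "lam ^ k \<le> 1" and t: "0 \<le> t"
    and \<mu>: "\<mu> = (\<integral>x. \<phi> x \<partial>M)" and p: "p = lam ^ k + (1 - lam ^ k) * \<mu>"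
  shows "prob {x \<in> space M. real j * \<eta> \<le> (\<Sum>i<j. \<phi> ((S ^^ (k * i)) x))}
           \<le> (exp (- (t * \<eta>)) * (1 - p + p * exp t)) ^ j"
proof -
  define g where "g = (\<lambda>x. exp (t * \<phi> x))"
  define f where "f = (\<lambda>x. \<Prod>i<j. g ((S ^^ (k * i)) x))"
  have \<phi>M [measurable]: "\<phi> \<in> borel_measurable M"
    using measurable_from_subalg[OF subalg \<phi>F] .
  have gF: "g \<in> borel_measurable F"
    unfolding g_def using \<phi>F by measurable
  have gM [measurable]: "g \<in> borel_measurable M"
    using measurable_from_subalg[OF subalg gF] .
  note [measurable] = S_pow_measurable
  have g_bounds: "0 \<le> g x \<and> g x \<le> exp t" if "x \<in> space M" for x
    using mult_left_mono[OF _ t, of "\<phi> x" 1] \<phi>[OF that] by (simp add: g_def)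
  have f_exp: "f x = exp (t * (\<Sum>i<j. \<phi> ((S ^^ (k * i)) x)))" for x
    by (simp add: f_def g_def exp_sum sum_distrib_left)
  have int\<phi>: "integrable M \<phi>"
    by (rule integrable_const_bound[of _ 1]) (use \<phi> in \<open>auto intro!: AE_I2\<close>)
  have intg: "integrable M g"
    by (rule integrable_const_bound[of _ "exp t"]) (use g_bounds in \<open>auto intro!: AE_I2\<close>)
  have "(\<integral>x. g x \<partial>M) \<le> (\<integral>x. 1 + \<phi> x * (exp t - 1) \<partial>M)"
  proof (rule integral_mono[OF intg])
    show "integrable M (\<lambda>x. 1 + \<phi> x * (exp t - 1))"
      using int\<phi> by simp
    fix x assume "x \<in> space M"
    then have "exp ((1 - \<phi> x) *\<^sub>R 0 + \<phi> x *\<^sub>R t) \<le> (1 - \<phi> x) * exp 0 + \<phi> x * exp t"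
      using \<phi> by (intro convex_onD[OF exp_convex]) auto
    then show "g x \<le> 1 + \<phi> x * (exp t - 1)"
      by (simp add: g_def algebra_simps)
  qed
  also have "\<dots> = 1 + \<mu> * (exp t - 1)"
    using int\<phi> by (simp add: \<mu> prob_space)
  finally have mean: "(\<integral>x. g x \<partial>M) \<le> 1 + \<mu> * (exp t - 1)" .
  have g_nonneg: "0 \<le> (\<integral>x. g x \<partial>M)"
    by (simp add: g_def)
  have "(\<integral>x. f x \<partial>M) \<le> ((1 - lam ^ k) * (\<integral>x. g x \<partial>M) + lam ^ k * exp t) ^ j"
    unfolding f_def by (rule multiplicative_moment_bound[OF gF g_bounds lam])
  also have "\<dots> \<le> (1 - p + p * exp t) ^ j"
  proof (rule power_mono)
    have "(1 - lam ^ k) * (\<integral>x. g x \<partial>M) + lam ^ k * exp t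
        \<le> (1 - lam ^ k) * (1 + \<mu> * (exp t - 1)) + lam ^ k * exp t"
      using mean lam by (intro add_right_mono mult_left_mono) auto
    then show "(1 - lam ^ k) * (\<integral>x. g x \<partial>M) + lam ^ k * exp t \<le> 1 - p + p * exp t"
      by (simp add: p algebra_simps)
    show "0 \<le> (1 - lam ^ k) * (\<integral>x. g x \<partial>M) + lam ^ k * exp t"
      using lam g_nonneg by simp
  qed
  finally have moment: "(\<integral>x. f x \<partial>M) \<le> (1 - p + p * exp t) ^ j" .
  have intf: "integrable M f"
  proof (rule integrable_const_bound[of _ "exp t ^ j"])
    show "f \<in> borel_measurable M"
      unfolding f_def by measurable
    have "f x \<le> exp t ^ j" if "x \<in> space M" for x
    proof -
      have "f x \<le> (\<Prod>i<j. exp t)"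
        unfolding f_def
        by (rule prod_mono) (rule g_bounds[OF measurable_space[OF S_pow_measurable that]])
      then show ?thesis
        by simp
    qed
    then show "AE x in M. norm (f x) \<le> exp t ^ j"
      by (intro AE_I2) (simp add: f_exp)
  qed
  have "{x \<in> space M. real j * \<eta> \<le> (\<Sum>i<j. \<phi> ((S ^^ (k * i)) x))}
      \<subseteq> {x \<in> space M. exp (t * (real j * \<eta>)) \<le> f x}"
    using t by (auto simp: f_exp intro: mult_left_mono)
  then have "prob {x \<in> space M. real j * \<eta> \<le> (\<Sum>i<j. \<phi> ((S ^^ (k * i)) x))}
      \<le> prob {x \<in> space M. exp (t * (real j * \<eta>)) \<le> f x}"
    using borel_measurable_integrable[OF intf] by (intro finite_measure_mono) auto
  also have "\<dots> \<le> (\<integral>x. f x \<partial>M) / exp (t * (real j * \<eta>))"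
    by (intro integral_Markov_inequality_measure[of _ _ "{}"] intf) (auto simp: f_exp)
  also have "\<dots> \<le> (1 - p + p * exp t) ^ j / exp (t * (real j * \<eta>))"
    using moment by (intro divide_right_mono) auto
  also have "\<dots> = (exp (- (t * \<eta>)) * (1 - p + p * exp t)) ^ j"
    by (simp add: power_mult_distrib exp_minus divide_inverse mult_ac power_inverse
        flip: exp_of_nat_mult)
  finally show ?thesis .
qed

lemma shifted_progression_prob:
  fixes \<phi> :: "'a \<Rightarrow> real"
  assumes \<phi>M [measurable]: "\<phi> \<in> borel_measurable M"
  shows "prob {x \<in> space M. c \<le> (\<Sum>i<j. \<phi> ((S ^^ (r + k * i)) x))}
    = prob {x \<in> space M. c \<le> (\<Sum>i<j. \<phi> ((S ^^ (k * i)) x))}"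
proof -
  note [measurable] = S_pow_measurable
  let ?A = "{x \<in> space M. c \<le> (\<Sum>i<j. \<phi> ((S ^^ (k * i)) x))}"
  have eq: "(S ^^ (r + k * i)) x = (S ^^ (k * i)) ((S ^^ r) x)" for i x
    by (metis add.commute comp_apply funpow_add)
  have "{x \<in> space M. c \<le> (\<Sum>i<j. \<phi> ((S ^^ (r + k * i)) x))} = (S ^^ r) -` ?A \<inter> space M"
    using measurable_space[OF S_pow_measurable] by (auto simp: eq)
  then have "prob {x \<in> space M. c \<le> (\<Sum>i<j. \<phi> ((S ^^ (r + k * i)) x))}
      = measure (distr M M (S ^^ r)) ?A"
    by (subst measure_distr) auto
  then show ?thesis
    by (simp only: distr_S_pow)
qed

text \<open>Some residue class has average at least \<open>\<eta>\<close>. A class has \<open>N \<ge> n/k - 1\<close> elements, and the loss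
  \<open>exp D(\<eta> \<parallel> p)\<close> from the summand \<open>-1\<close> is absorbed in \<open>exp D(\<eta> \<parallel> \<mu>)\<close>, because \<open>\<mu> \<le> p \<le> \<eta>\<close>.\<close>

lemma upper_tail:
  fixes \<phi> :: "'a \<Rightarrow> real"
  assumes \<phi>F: "\<phi> \<in> borel_measurable F" and \<phi>: "\<And>x. x \<in> space M \<Longrightarrow> \<phi> x \<in> {0..1}"
    and lam: "0 < lam" "lam < 1" and k: "1 \<le> k"
    and \<mu>: "\<mu> = (\<integral>x. \<phi> x \<partial>M)" "0 < \<mu>" "\<mu> < 1"
    and p: "p = lam ^ k + (1 - lam ^ k) * \<mu>" "p \<le> \<eta>" and \<eta>: "\<eta> \<le> 1"
  shows "prob {x \<in> space M. real n * \<eta> \<le> (\<Sum>i<n. \<phi> ((S ^^ i) x))}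
           \<le> real k * exp (bin_div \<eta> \<mu>) * exp (- (real n / real k * bin_div \<eta> p))"
proof -
  define \<theta> where "\<theta> = lam ^ k"
  define N where "N = (\<lambda>r. (n - r + k - 1) div k)"
  define A where "A = (\<lambda>r. {x \<in> space M. real (N r) * \<eta> \<le> (\<Sum>i<N r. \<phi> ((S ^^ (r + k * i)) x))})"
  define C where "C = exp (bin_div \<eta> \<mu>) * exp (- (real n / real k * bin_div \<eta> p))"
  have \<phi>M [measurable]: "\<phi> \<in> borel_measurable M"
    using measurable_from_subalg[OF subalg \<phi>F] .
  note [measurable] = S_pow_measurable
  have \<theta>: "0 < \<theta>" "\<theta> < 1"
    using lam k by (auto simp: \<theta>_def power_less_one_iff)
  have "p - \<mu> = \<theta> * (1 - \<mu>)" "1 - p = (1 - \<theta>) * (1 - \<mu>)"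
    by (simp_all add: p \<theta>_def algebra_simps)
  then have "0 < p - \<mu>" "0 < 1 - p"
    using \<theta> \<mu> by simp_all
  then have p01: "\<mu> \<le> p" "0 < p" "p < 1"
    using \<mu> by auto
  have D: "0 \<le> bin_div \<eta> p" "bin_div \<eta> p \<le> bin_div \<eta> \<mu>"
    using bin_div_nonneg bin_div_mono p01 p(2) \<eta> \<mu> by auto
  have A_le: "prob (A r) \<le> C" if r: "r < k" for r
  proof -
    have "prob (A r) \<le> exp (- (real (N r) * bin_div \<eta> p))"
      unfolding A_def shifted_progression_prob[OF \<phi>M]
      using \<theta> lam by (intro bernoulli_Chernoff p01 p(2) \<eta>
          progression_tail[OF \<phi>F \<phi> _ _ _ \<mu>(1) p(1)]) (auto simp: \<theta>_def)
    also have "\<dots> \<le> exp (bin_div \<eta> \<mu> + - (real n / real k * bin_div \<eta> p))"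
    proof -
      have "(real n / real k - 1) * bin_div \<eta> p \<le> real (N r) * bin_div \<eta> p"
        unfolding N_def using residue_class_size[OF k r] D(1) by (rule mult_right_mono)
      then show ?thesis
        using D(2) by (simp add: left_diff_distrib)
    qed
    finally show ?thesis
      by (simp only: C_def exp_add)
  qed
  have "{x \<in> space M. real n * \<eta> \<le> (\<Sum>i<n. \<phi> ((S ^^ i) x))} \<subseteq> (\<Union>r<k. A r)"
    using exists_residue_class_ge[OF k, where n=n and \<eta>=\<eta>] unfolding A_def N_def by blast
  moreover have A_sets: "A r \<in> sets M" for r
    unfolding A_def by measurable
  ultimately have "prob {x \<in> space M. real n * \<eta> \<le> (\<Sum>i<n. \<phi> ((S ^^ i) x))} \<le> prob (\<Union>r<k. A r)"
    by (intro finite_measure_mono) auto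
  also have "\<dots> \<le> (\<Sum>r<k. prob (A r))"
    by (intro finite_measure_subadditive_finite) (use A_sets in auto)
  also have "\<dots> \<le> (\<Sum>r<k. C)"
    using A_le by (intro sum_mono) auto
  finally show ?thesis
    by (simp add: C_def mult.assoc)
qed

text \<open>The gap condition on \<open>\<theta>\<close> says exactly that \<open>\<theta> + (1 - \<theta>) \<mu> \<le> \<eta>\<close>.\<close>

lemma upper_deviation:
  fixes \<phi> :: "'a \<Rightarrow> real"
  assumes \<phi>F: "\<phi> \<in> borel_measurable F" and \<phi>: "\<And>x. x \<in> space M \<Longrightarrow> \<phi> x \<in> {0..1}"
    and lam: "0 < lam" "lam < 1" and k: "1 \<le> k" and \<theta>: "\<theta> = lam ^ k"
    and \<mu>: "\<mu> = (\<integral>x. \<phi> x \<partial>M)" "\<mu> < 1" and \<eta>: "\<eta> \<le> 1"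
    and gap: "\<theta> \<le> (\<eta> - \<mu>) / (1 - \<mu>)" and n: "1 \<le> n"
  shows "ereal (prob {y \<in> space M. (1 / real n) * (\<Sum>i<n. \<phi> ((S ^^ i) y)) \<ge> \<eta>})
      \<le> ereal (ln \<theta> / ln lam) * exp_ereal (KL_binary \<eta> \<mu>) *
        exp_ereal (ereal (- (real n * (- ln lam))) *
          (KL_binary \<eta> (\<theta> + (1 - \<theta>) * \<mu>) / ereal (- ln \<theta>)))"
proof -
  define p where "p = \<theta> + (1 - \<theta>) * \<mu>"
  have \<theta>01: "0 < \<theta>" "\<theta> < 1"
    using lam k by (auto simp: \<theta> power_less_one_iff)
  have ln_lam: "ln lam < 0" and ln_\<theta>: "ln \<theta> = real k * ln lam"
    using lam by (auto simp: \<theta> ln_realpow)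
  have \<mu>0: "0 \<le> \<mu>"
    unfolding \<mu>(1) using \<phi> by (intro Bochner_Integration.integral_nonneg) auto
  have "1 - p = (1 - \<theta>) * (1 - \<mu>)"
    by (simp add: p_def algebra_simps)
  then have "0 < 1 - p"
    using \<theta>01 \<mu>(2) by simp
  moreover have "0 < p"
    unfolding p_def using \<theta>01 \<mu>0 by (intro add_pos_nonneg) auto
  ultimately have p01: "0 < p" "p < 1"
    by auto
  have "\<theta> * (1 - \<mu>) \<le> \<eta> - \<mu>"
    using gap \<mu>(2) by (simp add: pos_le_divide_eq)
  then have p_le: "p \<le> \<eta>"
    by (simp add: p_def algebra_simps)
  have factor: "ln \<theta> / ln lam = real k"
    using ln_lam by (simp add: ln_\<theta>)
  have "ereal (- (real n * (- ln lam))) * (KL_binary \<eta> p / ereal (- ln \<theta>))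
      = ereal (- (real n * (- ln lam)) * (bin_div \<eta> p / (- ln \<theta>)))"
    using p01 ln_lam k by (simp add: KL_binary_eq_bin_div ln_\<theta>)
  also have "- (real n * (- ln lam)) * (bin_div \<eta> p / (- ln \<theta>)) = - (real n / real k * bin_div \<eta> p)"
    using ln_lam k by (simp add: ln_\<theta> field_simps)
  finally have rate: "exp_ereal (ereal (- (real n * (- ln lam))) * (KL_binary \<eta> p / ereal (- ln \<theta>)))
      = ereal (exp (- (real n / real k * bin_div \<eta> p)))"
    by (simp add: exp_ereal_def)
  show ?thesis
  proof (cases "\<mu> = 0")
    case True
    \<comment> \<open>Here \<open>\<eta> \<ge> p > 0\<close>, so \<open>D(\<eta> \<parallel> \<mu>) = \<infinity>\<close>, while the last factor is positive: the bound is infinite.\<close>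
    then have "exp_ereal (KL_binary \<eta> \<mu>) = \<infinity>"
      using p01 p_le by (simp add: KL_binary_def exp_ereal_infinity)
    then show ?thesis
      using k unfolding factor p_def[symmetric] rate by simp
  next
    case False
    have "{y \<in> space M. (1 / real n) * (\<Sum>i<n. \<phi> ((S ^^ i) y)) \<ge> \<eta>}
        = {y \<in> space M. real n * \<eta> \<le> (\<Sum>i<n. \<phi> ((S ^^ i) y))}"
      using n by (auto simp: field_simps)
    moreover have "exp_ereal (KL_binary \<eta> \<mu>) = ereal (exp (bin_div \<eta> \<mu>))"
      using False \<mu>0 \<mu>(2) by (simp add: KL_binary_eq_bin_div exp_ereal_def)
    ultimately show ?thesis
      using upper_tail[OF \<phi>F \<phi> lam k \<mu>(1) _ \<mu>(2) p_def[unfolded \<theta>] p_le \<eta>, of n] False \<mu>0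
      unfolding factor p_def[symmetric] rate by simp
  qed
qed

end

section \<open>The deviation bound\<close>

lemma property_M_markov_subspace:
  assumes "dynamical_system_with_state_space M S N \<pi>"
    and "property_M M (state_algebra M N \<pi>) S"
  obtains V where "markov_subspace M S (state_algebra M N \<pi>) V"
proof -
  interpret dynamical_system_with_state_space M S N \<pi>
    by fact
  have "subalgebra M (state_algebra M N \<pi>)"
    unfolding subalgebra_def state_algebra_def
    using sets_vimage_algebra2[of \<pi> "space M" N] measurable_space[OF \<pi>_measurable]
      measurable_sets[OF \<pi>_measurable] by auto
  then interpret state_factor M S "state_algebra M N \<pi>"
    by unfold_locales
  obtain V where V: "closed_L2_subspace M V"
    "\<forall>g\<in>Linf_sub M (state_algebra M N \<pi>). \<forall>f\<in>V. (\<lambda>x. g x * f x) \<in> V"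
    "\<forall>f\<in>V. koopman S f \<in> V" "L2_sub M (state_algebra M N \<pi>) \<subseteq> V"
    "\<forall>f\<in>V. AE x in M. P (koopman S (P f)) x = P (koopman S f) x"
    using assms(2) unfolding property_M_def by blast
  have "markov_subspace M S (state_algebra M N \<pi>) V"
    by unfold_locales (rule V bspec[OF bspec[OF V(2)]] bspec[OF V(3)] bspec[OF V(5)]; assumption?)+
  then show ?thesis
    by (rule that)
qed

theorem theorem3p2:
  fixes M :: "'a measure" and S :: "'a \<Rightarrow> 'a"
    and N :: "'b measure" and \<pi> :: "'a \<Rightarrow> 'b"
    and \<phi> :: "'a \<Rightarrow> real" and lam \<mu> \<eta> \<theta> :: real and n :: nat
  assumes "dynamical_system_with_state_space M S N \<pi>"
    and "property_M M (state_algebra M N \<pi>) S"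
    and "lam = averaging_norm0 M (state_algebra M N \<pi>) S"
    and "0 < lam" and "lam < 1"
    and "\<phi> \<in> borel_measurable (state_algebra M N \<pi>)"
    and "\<phi> \<in> space M \<rightarrow> {0..1}"
    and "\<mu> = (\<integral>y. \<phi> y \<partial>M)"
    and "\<eta> \<in> {0..1}"
    and "n \<ge> 1"
    and "\<theta> \<in> {lam ^ k | k::nat. k \<ge> 1}"
  shows "(\<mu> < 1 \<and> \<eta> \<ge> \<mu> \<and> \<theta> \<le> (\<eta> - \<mu>) / (1 - \<mu>) \<longrightarrow>
      ereal (measure M {y \<in> space M. (1 / real n) * (\<Sum>i<n. \<phi> ((S ^^ i) y)) \<ge> \<eta>})
      \<le> ereal (ln \<theta> / ln lam) * exp_ereal (KL_binary \<eta> \<mu>) *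
        exp_ereal (ereal (- (real n * (- ln lam))) *
          (KL_binary \<eta> (\<theta> + (1 - \<theta>) * \<mu>) / ereal (- ln \<theta>))))
    \<and>
    (\<mu> > 0 \<and> \<eta> \<le> \<mu> \<and> \<theta> \<le> (\<mu> - \<eta>) / \<mu> \<longrightarrow>
      ereal (measure M {y \<in> space M. (1 / real n) * (\<Sum>i<n. \<phi> ((S ^^ i) y)) \<le> \<eta>})
      \<le> ereal (ln \<theta> / ln lam) * exp_ereal (KL_binary \<eta> \<mu>) *
        exp_ereal (ereal (- (real n * (- ln lam))) *
          (KL_binary \<eta> ((1 - \<theta>) * \<mu>) / ereal (- ln \<theta>))))"
proof -
  let ?F = "state_algebra M N \<pi>"
  obtain V where "markov_subspace M S ?F V"
    using property_M_markov_subspace[OF assms(1,2)] .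
  then interpret markov_subspace M S ?F V .
  obtain k where k: "1 \<le> k" "\<theta> = averaging_norm0 M ?F S ^ k"
    using assms by auto
  note lam = assms(4,5)[unfolded assms(3)]
  have \<phi>: "\<phi> x \<in> {0..1}" if "x \<in> space M" for x
    using assms(7) that by auto
  show ?thesis
  proof (intro conjI impI; elim conjE)
    assume "\<mu> < 1" "\<theta> \<le> (\<eta> - \<mu>) / (1 - \<mu>)"
    then show "ereal (prob {y \<in> space M. (1 / real n) * (\<Sum>i<n. \<phi> ((S ^^ i) y)) \<ge> \<eta>})
      \<le> ereal (ln \<theta> / ln lam) * exp_ereal (KL_binary \<eta> \<mu>) *
        exp_ereal (ereal (- (real n * (- ln lam))) *
          (KL_binary \<eta> (\<theta> + (1 - \<theta>) * \<mu>) / ereal (- ln \<theta>)))"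
      using assms(9,10) unfolding assms(3)
      by (intro upper_deviation[OF assms(6) \<phi> lam k assms(8)]) auto
  next
    assume \<mu>: "0 < \<mu>" and gap: "\<theta> \<le> (\<mu> - \<eta>) / \<mu>"
    define \<psi> where "\<psi> = (\<lambda>x. 1 - \<phi> x)"
    have \<psi>F: "\<psi> \<in> borel_measurable ?F"
      unfolding \<psi>_def using assms(6) by measurable
    have \<psi>: "\<psi> x \<in> {0..1}" if "x \<in> space M" for x
      using \<phi>[OF that] by (simp add: \<psi>_def)
    have "integrable M \<phi>"
      by (rule integrable_const_bound[of _ 1])
        (use \<phi> measurable_from_subalg[OF subalg assms(6)] in \<open>auto intro!: AE_I2\<close>)
    then have mean: "1 - \<mu> = (\<integral>x. \<psi> x \<partial>M)"
      by (simp add: \<psi>_def assms(8) prob_space)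
    have "{y \<in> space M. (1 / real n) * (\<Sum>i<n. \<phi> ((S ^^ i) y)) \<le> \<eta>}
        = {y \<in> space M. (1 / real n) * (\<Sum>i<n. \<psi> ((S ^^ i) y)) \<ge> 1 - \<eta>}"
      using assms(10) by (auto simp: \<psi>_def sum_subtractf field_simps)
    moreover have "\<theta> + (1 - \<theta>) * (1 - \<mu>) = 1 - (1 - \<theta>) * \<mu>"
      by (simp add: algebra_simps)
    moreover have "ereal (prob {y \<in> space M. (1 / real n) * (\<Sum>i<n. \<psi> ((S ^^ i) y)) \<ge> 1 - \<eta>})
      \<le> ereal (ln \<theta> / ln lam) * exp_ereal (KL_binary (1 - \<eta>) (1 - \<mu>)) *
        exp_ereal (ereal (- (real n * (- ln lam))) *
          (KL_binary (1 - \<eta>) (\<theta> + (1 - \<theta>) * (1 - \<mu>)) / ereal (- ln \<theta>)))"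
      using assms(9,10) \<mu> gap unfolding assms(3)
      by (intro upper_deviation[OF \<psi>F \<psi> lam k mean]) auto
    ultimately show "ereal (prob {y \<in> space M. (1 / real n) * (\<Sum>i<n. \<phi> ((S ^^ i) y)) \<le> \<eta>})
      \<le> ereal (ln \<theta> / ln lam) * exp_ereal (KL_binary \<eta> \<mu>) *
        exp_ereal (ereal (- (real n * (- ln lam))) *
          (KL_binary \<eta> ((1 - \<theta>) * \<mu>) / ereal (- ln \<theta>)))"
      by (simp only: KL_binary_complement)
  qed
qed

end
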